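(* Let $r\ge 1$ be an integer and let $M$ be a simple module over the Lie algebra $\mathfrak{a}_r$ such that the action of $\bar d_r$ on $M$ is injective. Then for any $\alpha\in\mathbb{C}$, the weight Virasoro module $\mathcal{N}(M,\alpha)$ is simple.
   Context: The Virasoro algebra $\mathfrak{V}$ is the complex Lie algebra with basis $\{c,d_i: i\in\mathbb{Z}\}$ and bracket $[d_i,d_j]=(j-i)d_{i+j}+\delta_{i,-j}\frac{i^3-i}{12}c$, $[d_i,c]=0$ for $i,j\in\mathbb{Z}$. Let $\mathfrak{V}_+$ be the Lie subalgebra of $\mathfrak{V}$ spanned by all $d_i$ with $i\geq 0$. For an integer $r\ge 0$ let $\mathfrak{V}_+^{(r)}$ be the Lie subalgebra generated by all $d_i$ with $i>r$ (it is an ideal of $\mathfrak{V}_+$), let $\mathfrak{a}_r=\mathfrak{V}_+/\mathfrak{V}_+^{(r)}$, and let $\bar d_i$ be the image of $d_i$ in $\mathfrak{a}_r$. For an $\mathfrak{a}_r$-module $M$ and $\alpha\in\mathbb{C}$, $\mathcal{N}(M,\alpha)$ is the $\mathfrak{V}$-module with underlying vector space $M\otimes\mathbb{C}[t,t^{-1}]$ and action $$d_m (v\otimes t^n)=\Big(\Big(\alpha+n+\sum_{i=0}^r\frac{m^{i+1}}{(i+1)!}\bar d_i\Big)v\Big)\otimes t^{n+m},\qquad c(v\otimes t^n)=0\qquad (m,n\in\mathbb{Z},\ v\in M).$$ A weight module is one on which $d_0$ acts diagonalizably; $\mathcal{N}(M,\alpha)$ is a weight module, with weight spaces $M\otimes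 t^n$ of $d_0$-eigenvalue $\alpha+n$. *)

theory Defs
  imports Complex_Main "HOL-Library.Poly_Mapping"
begin

section \<open>Complex Lie algebras and their modules\<close>

record 'a lie_struct =
  lcarrier :: "'a set"
  lzero :: 'a  (\<open>\<zero>\<index>\<close>)
  ladd :: "'a \<Rightarrow> 'a \<Rightarrow> 'a"  (infixl \<open>\<oplus>\<index>\<close> 65)
  lsmult :: "complex \<Rightarrow> 'a \<Rightarrow> 'a"  (infixr \<open>\<odot>\<index>\<close> 70)
  lbracket :: "'a \<Rightarrow> 'a \<Rightarrow> 'a"  (\<open>\<lbrace>_,/ _\<rbrace>\<index>\<close>)

locale complex_lie_algebra =
  fixes L :: "('a, 'x) lie_struct_scheme" (structure)
  assumes zero_closed: "\<zero> \<in> lcarrier L"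
    and add_closed: "\<lbrakk>x \<in> lcarrier L; y \<in> lcarrier L\<rbrakk> \<Longrightarrow> x \<oplus> y \<in> lcarrier L"
    and smult_closed: "x \<in> lcarrier L \<Longrightarrow> a \<odot> x \<in> lcarrier L"
    and bracket_closed: "\<lbrakk>x \<in> lcarrier L; y \<in> lcarrier L\<rbrakk> \<Longrightarrow> \<lbrace>x, y\<rbrace> \<in> lcarrier L"
    and add_assoc: "\<lbrakk>x \<in> lcarrier L; y \<in> lcarrier L; z \<in> lcarrier L\<rbrakk>
      \<Longrightarrow> (x \<oplus> y) \<oplus> z = x \<oplus> (y \<oplus> z)"
    and add_commute: "\<lbrakk>x \<in> lcarrier L; y \<in> lcarrier L\<rbrakk> \<Longrightarrow> x \<oplus> y = y \<oplus> x"
    and add_zero: "x \<in> lcarrier L \<Longrightarrow> \<zero> \<oplus> x = x"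
    and add_inverse: "x \<in> lcarrier L \<Longrightarrow> \<exists>y\<in>lcarrier L. y \<oplus> x = \<zero>"
    and smult_add_right: "\<lbrakk>x \<in> lcarrier L; y \<in> lcarrier L\<rbrakk>
      \<Longrightarrow> a \<odot> (x \<oplus> y) = (a \<odot> x) \<oplus> (a \<odot> y)"
    and smult_add_left: "x \<in> lcarrier L \<Longrightarrow> (a + b) \<odot> x = (a \<odot> x) \<oplus> (b \<odot> x)"
    and smult_smult: "x \<in> lcarrier L \<Longrightarrow> a \<odot> (b \<odot> x) = (a * b) \<odot> x"
    and smult_one: "x \<in> lcarrier L \<Longrightarrow> 1 \<odot> x = x"
    and bracket_add_left: "\<lbrakk>x \<in> lcarrier L; y \<in> lcarrier L; z \<in> lcarrier L\<rbrakk>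
      \<Longrightarrow> \<lbrace>x \<oplus> y, z\<rbrace> = \<lbrace>x, z\<rbrace> \<oplus> \<lbrace>y, z\<rbrace>"
    and bracket_add_right: "\<lbrakk>x \<in> lcarrier L; y \<in> lcarrier L; z \<in> lcarrier L\<rbrakk>
      \<Longrightarrow> \<lbrace>x, y \<oplus> z\<rbrace> = \<lbrace>x, y\<rbrace> \<oplus> \<lbrace>x, z\<rbrace>"
    and bracket_smult_left: "\<lbrakk>x \<in> lcarrier L; y \<in> lcarrier L\<rbrakk> \<Longrightarrow> \<lbrace>a \<odot> x, y\<rbrace> = a \<odot> \<lbrace>x, y\<rbrace>"
    and bracket_smult_right: "\<lbrakk>x \<in> lcarrier L; y \<in> lcarrier L\<rbrakk> \<Longrightarrow> \<lbrace>x, a \<odot> y\<rbrace> = a \<odot> \<lbrace>x, y\<rbrace>"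
    and bracket_self: "x \<in> lcarrier L \<Longrightarrow> \<lbrace>x, x\<rbrace> = \<zero>"
    and jacobi: "\<lbrakk>x \<in> lcarrier L; y \<in> lcarrier L; z \<in> lcarrier L\<rbrakk>
      \<Longrightarrow> (\<lbrace>x, \<lbrace>y, z\<rbrace>\<rbrace> \<oplus> \<lbrace>y, \<lbrace>z, x\<rbrace>\<rbrace>) \<oplus> \<lbrace>z, \<lbrace>x, y\<rbrace>\<rbrace> = \<zero>"

definition lie_subalgebra :: "('a, 'x) lie_struct_scheme \<Rightarrow> 'a set \<Rightarrow> bool" where
  "lie_subalgebra L H \<longleftrightarrow> H \<subseteq> lcarrier L \<and> lzero L \<in> H \<and>
     (\<forall>x\<in>H. \<forall>y\<in>H. ladd L x y \<in> H) \<and> (\<forall>a. \<forall>x\<in>H. lsmult L a x \<in> H) \<and>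
     (\<forall>x\<in>H. \<forall>y\<in>H. lbracket L x y \<in> H)"

definition lie_generated :: "('a, 'x) lie_struct_scheme \<Rightarrow> 'a set \<Rightarrow> 'a set" where
  "lie_generated L S = \<Inter>{H. lie_subalgebra L H \<and> S \<subseteq> H}"

definition lie_ideal :: "('a, 'x) lie_struct_scheme \<Rightarrow> 'a set \<Rightarrow> bool" where
  "lie_ideal L I \<longleftrightarrow> lie_subalgebra L I \<and> (\<forall>x\<in>lcarrier L. \<forall>y\<in>I. lbracket L x y \<in> I)"

definition lie_coset :: "('a, 'x) lie_struct_scheme \<Rightarrow> 'a set \<Rightarrow> 'a \<Rightarrow> 'a set" where
  "lie_coset L I x = ladd L x ` I"

definition lie_quotient :: "('a, 'x) lie_struct_scheme \<Rightarrow> 'a set \<Rightarrow> 'a set lie_struct" where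
  "lie_quotient L I = \<lparr>lcarrier = lie_coset L I ` lcarrier L,
     lzero = lie_coset L I (lzero L),
     ladd = (\<lambda>X Y. \<Union>x\<in>X. \<Union>y\<in>Y. lie_coset L I (ladd L x y)),
     lsmult = (\<lambda>a X. \<Union>x\<in>X. lie_coset L I (lsmult L a x)),
     lbracket = (\<lambda>X Y. \<Union>x\<in>X. \<Union>y\<in>Y. lie_coset L I (lbracket L x y))\<rparr>"

text \<open>The underlying space of a module is a whole type with a scalar multiplication \<open>scale\<close>;
  \<open>act x\<close> is constrained only for \<open>x\<close> in the carrier of the Lie algebra.\<close>

locale lie_module = complex_lie_algebra L + vector_space scale
  for L :: "('a, 'x) lie_struct_scheme" (structure)
    and scale :: "complex \<Rightarrow> 'm::ab_group_add \<Rightarrow> 'm"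
    and act :: "'a \<Rightarrow> 'm \<Rightarrow> 'm" +
  assumes act_add_right: "x \<in> lcarrier L \<Longrightarrow> act x (v + w) = act x v + act x w"
    and act_scale_right: "x \<in> lcarrier L \<Longrightarrow> act x (scale a v) = scale a (act x v)"
    and act_add_left: "\<lbrakk>x \<in> lcarrier L; y \<in> lcarrier L\<rbrakk> \<Longrightarrow> act (x \<oplus> y) v = act x v + act y v"
    and act_smult_left: "x \<in> lcarrier L \<Longrightarrow> act (a \<odot> x) v = scale a (act x v)"
    and act_bracket: "\<lbrakk>x \<in> lcarrier L; y \<in> lcarrier L\<rbrakk>
      \<Longrightarrow> act \<lbrace>x, y\<rbrace> v = act x (act y v) - act y (act x v)"

definition lie_submodule ::
  "('a, 'x) lie_struct_scheme \<Rightarrow> (complex \<Rightarrow> 'm::ab_group_add \<Rightarrow> 'm) \<Rightarrow> ('a \<Rightarrow> 'm \<Rightarrow> 'm) \<Rightarrow> 'm set \<Rightarrow> bool"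
  where
  "lie_submodule L scale act W \<longleftrightarrow>
     module.subspace scale W \<and> (\<forall>x\<in>lcarrier L. \<forall>w\<in>W. act x w \<in> W)"

definition simple_lie_module ::
  "('a, 'x) lie_struct_scheme \<Rightarrow> (complex \<Rightarrow> 'm::ab_group_add \<Rightarrow> 'm) \<Rightarrow> ('a \<Rightarrow> 'm \<Rightarrow> 'm) \<Rightarrow> bool"
  where
  "simple_lie_module L scale act \<longleftrightarrow>
     lie_module L scale act \<and> (\<exists>v::'m. v \<noteq> 0) \<and>
     (\<forall>W. lie_submodule L scale act W \<longrightarrow> W = {0} \<or> W = UNIV)"


section \<open>The Virasoro algebra and the quotients of its nonnegative part\<close>

datatype vir_basis = C | D int

type_synonym vir = "vir_basis \<Rightarrow>\<^sub>0 complex"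

text \<open>Scalar multiplication on finitely supported functions, induced by one on the values.\<close>

definition pm_scale :: "('s \<Rightarrow> 'm \<Rightarrow> 'm) \<Rightarrow> 's \<Rightarrow> ('k \<Rightarrow>\<^sub>0 'm::zero) \<Rightarrow> ('k \<Rightarrow>\<^sub>0 'm)" where
  "pm_scale scale a f = Poly_Mapping.map (scale a) f"

text \<open>The linear extension of a map \<open>g\<close> given on basis vectors.\<close>

definition lin_ext :: "(complex \<Rightarrow> 'm::ab_group_add \<Rightarrow> 'm) \<Rightarrow> ('k \<Rightarrow> 'm) \<Rightarrow> ('k \<Rightarrow>\<^sub>0 complex) \<Rightarrow> 'm" where
  "lin_ext scale g x = (\<Sum>k\<in>Poly_Mapping.keys x. scale (Poly_Mapping.lookup x k) (g k))"

fun basis_bracket :: "vir_basis \<Rightarrow> vir_basis \<Rightarrow> vir" where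
  "basis_bracket (D i) (D j) =
     Poly_Mapping.single (D (i + j)) (of_int (j - i)) +
     (if i = - j then Poly_Mapping.single C (of_int (i ^ 3 - i) / 12) else 0)"
| "basis_bracket C _ = 0"
| "basis_bracket (D _) C = 0"

definition vir_bracket :: "vir \<Rightarrow> vir \<Rightarrow> vir" where
  "vir_bracket x y =
     lin_ext (pm_scale (*)) (\<lambda>p. lin_ext (pm_scale (*)) (\<lambda>q. basis_bracket p q) y) x"

definition virasoro :: "vir lie_struct" where
  "virasoro = \<lparr>lcarrier = UNIV, lzero = 0, ladd = (+), lsmult = pm_scale (*),
     lbracket = vir_bracket\<rparr>"

definition vir_c :: vir where
  "vir_c = Poly_Mapping.single C 1"

definition vir_d :: "int \<Rightarrow> vir" where
  "vir_d i = Poly_Mapping.single (D i) 1"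

definition vir_plus :: "vir lie_struct" where
  "vir_plus = virasoro\<lparr>lcarrier := module.span (pm_scale (*)) {vir_d i |i. 0 \<le> i}\<rparr>"

definition vir_plus_ideal :: "nat \<Rightarrow> vir set" where
  "vir_plus_ideal r = lie_generated virasoro {vir_d i |i. int r < i}"

definition a_alg :: "nat \<Rightarrow> vir set lie_struct" where
  "a_alg r = lie_quotient vir_plus (vir_plus_ideal r)"

definition dbar :: "nat \<Rightarrow> nat \<Rightarrow> vir set" where
  "dbar r i = lie_coset vir_plus (vir_plus_ideal r) (vir_d (int i))"


section \<open>The modules \<open>N(M, \<alpha>)\<close>\<close>

text \<open>The space \<open>M \<otimes> \<complex>[t, t\<inverse>]\<close> is realised as the finitely supported functions from the
  integers to \<open>M\<close>, with \<open>v \<otimes> t\<^sup>n\<close> being \<open>Poly_Mapping.single n v\<close>.\<close>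

definition N_scale :: "(complex \<Rightarrow> 'm::ab_group_add \<Rightarrow> 'm) \<Rightarrow> complex \<Rightarrow> (int \<Rightarrow>\<^sub>0 'm) \<Rightarrow> (int \<Rightarrow>\<^sub>0 'm)" where
  "N_scale scale = pm_scale scale"

definition N_coeff ::
  "nat \<Rightarrow> (complex \<Rightarrow> 'm::ab_group_add \<Rightarrow> 'm) \<Rightarrow> (vir set \<Rightarrow> 'm \<Rightarrow> 'm) \<Rightarrow> complex \<Rightarrow> int \<Rightarrow> int \<Rightarrow> 'm \<Rightarrow> 'm"
  where
  "N_coeff r scale act \<alpha> m n v =
     scale (\<alpha> + of_int n) v +
     (\<Sum>i\<le>r. scale (of_int m ^ (i + 1) / fact (i + 1)) (act (dbar r i) v))"

fun N_basis ::
  "nat \<Rightarrow> (complex \<Rightarrow> 'm::ab_group_add \<Rightarrow> 'm) \<Rightarrow> (vir set \<Rightarrow> 'm \<Rightarrow> 'm) \<Rightarrow> complex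
    \<Rightarrow> vir_basis \<Rightarrow> (int \<Rightarrow>\<^sub>0 'm) \<Rightarrow> (int \<Rightarrow>\<^sub>0 'm)"
  where
  "N_basis r scale act \<alpha> (D m) f =
     (\<Sum>n\<in>Poly_Mapping.keys f.
        Poly_Mapping.single (n + m) (N_coeff r scale act \<alpha> m n (Poly_Mapping.lookup f n)))"
| "N_basis r scale act \<alpha> C f = 0"

definition N_act ::
  "nat \<Rightarrow> (complex \<Rightarrow> 'm::ab_group_add \<Rightarrow> 'm) \<Rightarrow> (vir set \<Rightarrow> 'm \<Rightarrow> 'm) \<Rightarrow> complex
    \<Rightarrow> vir \<Rightarrow> (int \<Rightarrow>\<^sub>0 'm) \<Rightarrow> (int \<Rightarrow>\<^sub>0 'm)"
  where
  "N_act r scale act \<alpha> x f = lin_ext (N_scale scale) (\<lambda>p. N_basis r scale act \<alpha> p f) x"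

definition weight_module ::
  "(complex \<Rightarrow> 'm::ab_group_add \<Rightarrow> 'm) \<Rightarrow> (vir \<Rightarrow> 'm \<Rightarrow> 'm) \<Rightarrow> bool" where
  "weight_module scale act \<longleftrightarrow>
     lie_module virasoro scale act \<and>
     module.span scale {v. \<exists>a. act (vir_d 0) v = scale a v} = UNIV"


section \<open>The Virasoro algebra is a Lie algebra\<close>

lemma lookup_pm_scale:
  assumes "scale a 0 = 0"
  shows "Poly_Mapping.lookup (pm_scale scale a f) k = scale a (Poly_Mapping.lookup f k)"
  using assms by (simp add: pm_scale_def Poly_Mapping.map.rep_eq when_def)

lemma vector_space_pm_scale:
  assumes "vector_space scale"
  shows "vector_space (pm_scale scale)"
proof -
  interpret vector_space scale by fact
  show ?thesis
    by unfold_locales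
      (auto intro!: poly_mapping_eqI simp: lookup_pm_scale lookup_add
        scale_right_distrib scale_left_distrib)
qed

lemma vector_space_complex: "vector_space ((*) :: complex \<Rightarrow> complex \<Rightarrow> complex)"
  by unfold_locales (auto simp: algebra_simps)

interpretation vir: vector_space "pm_scale (*) :: complex \<Rightarrow> vir \<Rightarrow> vir"
  by (intro vector_space_pm_scale vector_space_complex)

lemma pm_scale_single:
  assumes "scale a 0 = 0"
  shows "pm_scale scale a (Poly_Mapping.single k v) = Poly_Mapping.single k (scale a v)"
  by (rule poly_mapping_eqI) (use assms in \<open>auto simp: lookup_pm_scale lookup_single when_def\<close>)

lemma poly_mapping_sum_single:
  fixes x :: "'k \<Rightarrow>\<^sub>0 'm::comm_monoid_add"
  shows "x = (\<Sum>k\<in>Poly_Mapping.keys x. Poly_Mapping.single k (Poly_Mapping.lookup x k))"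
proof (rule poly_mapping_eqI)
  fix j
  show "Poly_Mapping.lookup x j = Poly_Mapping.lookup
    (\<Sum>k\<in>Poly_Mapping.keys x. Poly_Mapping.single k (Poly_Mapping.lookup x k)) j"
    by (auto simp: lookup_sum lookup_single when_def sum.delta in_keys_iff)
qed

lemma poly_mapping_add_induct [case_names zero single add]:
  fixes x :: "'k \<Rightarrow>\<^sub>0 'm::comm_monoid_add"
  assumes "P 0" "\<And>k a. P (Poly_Mapping.single k a)" "\<And>x y. P x \<Longrightarrow> P y \<Longrightarrow> P (x + y)"
  shows "P x"
proof -
  have "P (\<Sum>k\<in>A. Poly_Mapping.single k (Poly_Mapping.lookup x k))" if "finite A" for A
    using that by (induction A) (auto intro: assms)
  then show ?thesis
    using poly_mapping_sum_single[of x] by (metis finite_keys)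
qed

lemma lin_ext_superset:
  assumes "vector_space scale" "finite A" "Poly_Mapping.keys x \<subseteq> A"
  shows "lin_ext scale g x = (\<Sum>k\<in>A. scale (Poly_Mapping.lookup x k) (g k))"
proof -
  interpret vector_space scale by fact
  show ?thesis
    unfolding lin_ext_def
    by (rule sum.mono_neutral_left) (use assms in \<open>auto simp: in_keys_iff\<close>)
qed

lemma lin_ext_add:
  assumes "vector_space scale"
  shows "lin_ext scale g (x + y) = lin_ext scale g x + lin_ext scale g y"
proof -
  interpret vector_space scale by fact
  let ?A = "Poly_Mapping.keys x \<union> Poly_Mapping.keys y"
  have "lin_ext scale g z = (\<Sum>k\<in>?A. scale (Poly_Mapping.lookup z k) (g k))"
    if "Poly_Mapping.keys z \<subseteq> ?A" for z
    using that by (intro lin_ext_superset assms) auto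
  then show ?thesis
    using Poly_Mapping.keys_add[of x y]
    by (simp add: lookup_add scale_left_distrib sum.distrib)
qed

lemma lin_ext_scale:
  assumes "vector_space scale"
  shows "lin_ext scale g (pm_scale (*) a x) = scale a (lin_ext scale g x)"
proof -
  interpret vector_space scale by fact
  have "lin_ext scale g (pm_scale (*) a x) =
      (\<Sum>k\<in>Poly_Mapping.keys x. scale (Poly_Mapping.lookup (pm_scale (*) a x) k) (g k))"
    by (intro lin_ext_superset assms) (auto simp: in_keys_iff lookup_pm_scale)
  then show ?thesis
    by (simp add: lookup_pm_scale lin_ext_def scale_sum_right)
qed

lemma lin_ext_single:
  assumes "vector_space scale"
  shows "lin_ext scale g (Poly_Mapping.single k a) = scale a (g k)"
proof -
  interpret vector_space scale by fact
  show ?thesis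
    by (subst lin_ext_superset[OF assms, of "{k}"]) auto
qed

lemma lin_ext_fun_add:
  assumes "vector_space scale"
  shows "lin_ext scale (\<lambda>k. g k + h k) x = lin_ext scale g x + lin_ext scale h x"
proof -
  interpret vector_space scale by fact
  show ?thesis by (simp add: lin_ext_def scale_right_distrib sum.distrib)
qed

lemma lin_ext_fun_scale:
  assumes "vector_space scale"
  shows "lin_ext scale (\<lambda>k. scale a (g k)) x = scale a (lin_ext scale g x)"
proof -
  interpret vector_space scale by fact
  show ?thesis by (simp add: lin_ext_def scale_sum_right mult.commute)
qed

lemmas vir_vs = vir.vector_space_axioms

lemma vir_bracket_add_left: "vir_bracket (x + y) z = vir_bracket x z + vir_bracket y z"
  and vir_bracket_add_right: "vir_bracket z (x + y) = vir_bracket z x + vir_bracket z y"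
  and vir_bracket_scale_left: "vir_bracket (pm_scale (*) a x) z = pm_scale (*) a (vir_bracket x z)"
  and vir_bracket_scale_right: "vir_bracket z (pm_scale (*) a x) = pm_scale (*) a (vir_bracket z x)"
  by (simp_all add: vir_bracket_def lin_ext_add[OF vir_vs] lin_ext_scale[OF vir_vs]
      lin_ext_fun_add[OF vir_vs] lin_ext_fun_scale[OF vir_vs])

lemma vir_bracket_zero [simp]: "vir_bracket 0 x = 0" "vir_bracket x 0 = 0"
  using vir_bracket_add_left[of 0 0] vir_bracket_add_right[of _ 0 0] by simp_all

lemma vir_bracket_single:
  "vir_bracket (Poly_Mapping.single p a) (Poly_Mapping.single q b) =
     pm_scale (*) (a * b) (basis_bracket p q)"
  by (simp add: vir_bracket_def lin_ext_single[OF vir_vs])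

lemma vir_bracket_d:
  "vir_bracket (vir_d i) (vir_d j) = pm_scale (*) (of_int (j - i)) (vir_d (i + j)) +
     (if i = - j then pm_scale (*) (of_int (i ^ 3 - i) / 12) vir_c else 0)"
  by (simp add: vir_d_def vir_c_def vir_bracket_single pm_scale_single)

lemma vir_bracket_c: "vir_bracket (vir_d i) vir_c = 0"
  by (simp add: vir_d_def vir_c_def vir_bracket_single)

lemma basis_bracket_antisym: "basis_bracket p q = - basis_bracket q p"
proof (cases p; cases q)
  fix i j assume pq: "p = D i" "q = D j"
  have 1: "Poly_Mapping.single (D (i + j)) (of_int (j - i) :: complex) =
      - Poly_Mapping.single (D (j + i)) (of_int (i - j))"
    by (simp only: single_uminus[symmetric]) (simp add: add.commute)
  have 2: "Poly_Mapping.single C (of_int (i ^ 3 - i) / 12 :: complex) =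
      - Poly_Mapping.single C (of_int (j ^ 3 - j) / 12)" if "i = - j"
  proof -
    have "(of_int (i ^ 3 - i) / 12 :: complex) = - (of_int (j ^ 3 - j) / 12)"
      using that by (simp add: field_simps)
    then show ?thesis by (simp only: single_uminus)
  qed
  show ?thesis
  proof (cases "i = - j")
    case True
    then have j: "j = - i" by simp
    show ?thesis
      unfolding pq basis_bracket.simps if_P[OF True] if_P[OF j] 1 2[OF True]
      by (rule minus_add_distrib[symmetric])
  next
    case False
    then have "j \<noteq> - i" by auto
    with False show ?thesis
      unfolding pq basis_bracket.simps 1 by simp
  qed
qed auto

lemma vir_bracket_antisym: "vir_bracket x y = - vir_bracket y x"
proof (induction x rule: poly_mapping_add_induct)
  case (single p a)
  show ?case
  proof (induction y rule: poly_mapping_add_induct)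
    case (single q b)
    show ?case
      using basis_bracket_antisym[of p q] by (simp add: vir_bracket_single mult.commute)
  qed (simp_all add: vir_bracket_add_left vir_bracket_add_right)
qed (simp_all add: vir_bracket_add_left vir_bracket_add_right)

lemma vir_bracket_self: "vir_bracket x x = 0"
proof (rule poly_mapping_eqI)
  fix k
  have "Poly_Mapping.lookup (vir_bracket x x) k = - Poly_Mapping.lookup (vir_bracket x x) k"
    by (metis vir_bracket_antisym lookup_uminus)
  then show "Poly_Mapping.lookup (vir_bracket x x) k = Poly_Mapping.lookup 0 k"
    by simp
qed

definition vir_jac where
  "vir_jac x y z = vir_bracket x (vir_bracket y z) + vir_bracket y (vir_bracket z x)
     + vir_bracket z (vir_bracket x y)"

lemma vir_jac_basis:
  "vir_jac (Poly_Mapping.single p 1) (Poly_Mapping.single q 1) (Poly_Mapping.single s 1) = 0"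
proof (cases p; cases q; cases s)
  fix i j k assume *: "p = D i" "q = D j" "s = D k"
  have br: "vir_bracket (Poly_Mapping.single (D i) 1)
      (vir_bracket (Poly_Mapping.single (D j) 1) (Poly_Mapping.single (D k) 1)) =
      Poly_Mapping.single (D (i + j + k)) (of_int ((k - j) * (j + k - i))) +
      Poly_Mapping.single C (if i + j + k = 0 then of_int ((k - j) * (i ^ 3 - i)) / 12 else 0)" for i j k
    by (auto simp: vir_bracket_single vir_bracket_add_right pm_scale_single
        vir.scale_right_distrib add.assoc)
  have 1: "(k - j) * (j + k - i) + (i - k) * (k + i - j) + (j - i) * (i + j - k) = 0"
    by (simp add: algebra_simps)
  have 2: "(k - j) * (i ^ 3 - i) + (i - k) * (j ^ 3 - j) + (j - i) * (k ^ 3 - k) = 0"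
    if "i + j + k = 0"
  proof -
    have k: "k = - i - j" using that by simp
    show ?thesis unfolding k by (simp add: algebra_simps power3_eq_cube)
  qed
  have 1: "of_int ((k - j) * (j + k - i)) + of_int ((i - k) * (k + i - j)) + of_int ((j - i) * (i + j - k)) = (0::complex)"
    unfolding of_int_add[symmetric] 1 by simp
  have 2: "of_int ((k - j) * (i ^ 3 - i)) / 12 + of_int ((i - k) * (j ^ 3 - j)) / 12 + of_int ((j - i) * (k ^ 3 - k)) / 12 = (0::complex)"
    if "i + j + k = 0"
    unfolding add_divide_distrib[symmetric] of_int_add[symmetric] 2[OF that] by simp
  have e: "j + k + i = i + j + k" "k + i + j = i + j + k" by simp_all
  have comb: "(Poly_Mapping.single u a1 + Poly_Mapping.single v b1) +
      (Poly_Mapping.single u a2 + Poly_Mapping.single v b2) +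
      (Poly_Mapping.single u a3 + Poly_Mapping.single v b3) =
      Poly_Mapping.single u (a1 + a2 + a3) + Poly_Mapping.single v (b1 + b2 + b3)"
    for u v :: vir_basis and a1 a2 a3 b1 b2 b3 :: complex
    by (simp add: single_add ac_simps)
  show ?thesis
    unfolding * vir_jac_def br e comb 1 using 2 by (cases "i + j + k = 0") simp_all
qed (auto simp: vir_jac_def vir_bracket_single vir_bracket_add_right vir.scale_right_distrib pm_scale_single)

lemma vir_jac_add:
  "vir_jac (x + x') y z = vir_jac x y z + vir_jac x' y z"
  "vir_jac x (y + y') z = vir_jac x y z + vir_jac x y' z"
  "vir_jac x y (z + z') = vir_jac x y z + vir_jac x y z'"
  by (simp_all add: vir_jac_def vir_bracket_add_left vir_bracket_add_right)

lemma vir_jac_scale: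
  "vir_jac (pm_scale (*) a x) y z = pm_scale (*) a (vir_jac x y z)"
  "vir_jac x (pm_scale (*) a y) z = pm_scale (*) a (vir_jac x y z)"
  "vir_jac x y (pm_scale (*) a z) = pm_scale (*) a (vir_jac x y z)"
  by (simp_all add: vir_jac_def vir_bracket_scale_left vir_bracket_scale_right vir.scale_right_distrib)

lemma single_eq_scale: "Poly_Mapping.single p (a::complex) = pm_scale (*) a (Poly_Mapping.single p 1)"
  by (simp add: pm_scale_single)

lemma vir_jacobi: "vir_jac x y z = 0"
proof (induction x rule: poly_mapping_add_induct)
  case x: (single p a)
  show ?case
  proof (induction y rule: poly_mapping_add_induct)
    case y: (single q b)
    show ?case
    proof (induction z rule: poly_mapping_add_induct)
      case (single s d)
      show ?case
        by (subst (1 2 3) single_eq_scale) (simp add: vir_jac_scale vir_jac_basis del: pm_scale_single)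
    qed (simp_all add: vir_jac_add, simp add: vir_jac_def)
  qed (simp_all add: vir_jac_add, simp add: vir_jac_def)
qed (simp_all add: vir_jac_add, simp add: vir_jac_def)

lemma virasoro_sel [simp]: "lcarrier virasoro = UNIV" "lzero virasoro = 0" "ladd virasoro = (+)"
  "lsmult virasoro = pm_scale (*)" "lbracket virasoro = vir_bracket"
  by (simp_all add: virasoro_def)

lemma complex_lie_algebra_virasoro: "complex_lie_algebra virasoro"
  using vir_jacobi
  by unfold_locales
    (auto simp: vir.scale_right_distrib vir.scale_left_distrib vir_bracket_add_left vir_bracket_add_right
      vir_bracket_scale_left vir_bracket_scale_right vir_bracket_self vir_jac_def add_eq_0_iff2)

lemma complex_lie_algebra_subalgebra:
  assumes "complex_lie_algebra L" "lie_subalgebra L H"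
  shows "complex_lie_algebra (L\<lparr>lcarrier := H\<rparr>)"
proof -
  interpret complex_lie_algebra L by fact
  have sub: "x \<in> lcarrier L" if "x \<in> H" for x
    using assms(2) that by (auto simp: lie_subalgebra_def)
  have sm0: "lsmult L 0 x = lzero L" if "x \<in> lcarrier L" for x
    by (smt (verit) add_0 add_assoc add_inverse add_zero smult_add_left smult_closed that add_commute zero_closed)
  have inv: "\<exists>y\<in>H. ladd L y x = lzero L" if "x \<in> H" for x
  proof
    show "lsmult L (-1) x \<in> H" using assms(2) that by (auto simp: lie_subalgebra_def)
    show "ladd L (lsmult L (-1) x) x = lzero L"
      using smult_add_left[OF sub[OF that], of "-1" 1] sm0[OF sub[OF that]] smult_one[OF sub[OF that]]
      by simp
  qed
  show ?thesis
    using assms(2)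
    by unfold_locales
      (simp_all add: sub inv add_zero smult_add_right smult_add_left smult_smult smult_one
        bracket_add_left bracket_add_right bracket_smult_left bracket_smult_right bracket_self
        jacobi lie_subalgebra_def, auto intro: sub add_commute add_assoc)
qed


section \<open>The quotient of a Lie algebra by an ideal, and \<open>a_alg r\<close>\<close>

lemma span_d_subalgebra:
  assumes "0 \<le> s"
  shows "lie_subalgebra virasoro (vir.span {vir_d i |i. s \<le> i})"
proof -
  let ?S = "{vir_d i |i. s \<le> i}"
  have "vir_bracket x y \<in> vir.span ?S" if x: "x \<in> vir.span ?S" and y: "y \<in> vir.span ?S" for x y
    using x
  proof (induction rule: vir.span_induct_alt)
    case (step a x x')
    then obtain i where i: "x = vir_d i" "s \<le> i" by auto
    have "vir_bracket (vir_d i) y \<in> vir.span ?S"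
      using y
    proof (induction rule: vir.span_induct_alt)
      case (step b y y')
      then obtain j where j: "y = vir_d j" "s \<le> j" by auto
      have "i = - j \<Longrightarrow> i = 0 \<and> j = 0" using assms i(2) j(2) by linarith
      then have "vir_bracket (vir_d i) (vir_d j) = pm_scale (*) (of_int (j - i)) (vir_d (i + j))"
        by (auto simp: vir_bracket_d)
      moreover have "vir_d (i + j) \<in> ?S" using assms i(2) j(2) by force
      ultimately show ?case
        using step unfolding j(1)
        by (simp add: vir_bracket_add_right vir_bracket_scale_right vir.span_add vir.span_scale vir.span_base)
    qed (simp add: vir.span_zero)
    then show ?case
      using step unfolding i(1)
      by (simp add: vir_bracket_add_left vir_bracket_scale_left vir.span_add vir.span_scale)
  qed (simp add: vir.span_zero)
  then show ?thesis
    by (auto simp: lie_subalgebra_def vir.span_zero vir.span_add vir.span_scale)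
qed

lemma vir_plus_ideal_eq: "vir_plus_ideal r = vir.span {vir_d i |i. int r < i}"
proof
  have "lie_subalgebra virasoro (vir.span {vir_d i |i. int r < i})"
    using span_d_subalgebra[of "int r + 1"] by (simp add: add1_zle_eq)
  then show "vir_plus_ideal r \<subseteq> vir.span {vir_d i |i. int r < i}"
    unfolding vir_plus_ideal_def lie_generated_def
    by (intro Inter_lower CollectI conjI vir.span_superset)
  show "vir.span {vir_d i |i. int r < i} \<subseteq> vir_plus_ideal r"
    unfolding vir_plus_ideal_def lie_generated_def
  proof (intro Inter_greatest vir.span_minimal)
    fix H assume "H \<in> {H. lie_subalgebra virasoro H \<and> {vir_d i |i. int r < i} \<subseteq> H}"
    then show "{vir_d i |i. int r < i} \<subseteq> H" "vir.subspace H"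
      by (auto simp: lie_subalgebra_def vir.subspace_def)
  qed
qed

lemma lie_ideal_vir_plus: "lie_ideal vir_plus (vir_plus_ideal r)"
proof -
  let ?S = "{vir_d i |i. int r < i}" and ?P = "{vir_d i |i. 0 \<le> i}"
  have "vir_bracket x y \<in> vir.span ?S" if x: "x \<in> vir.span ?P" and y: "y \<in> vir.span ?S" for x y
    using x
  proof (induction rule: vir.span_induct_alt)
    case (step a x x')
    then obtain i where i: "x = vir_d i" "0 \<le> i" by auto
    have "vir_bracket (vir_d i) y \<in> vir.span ?S"
      using y
    proof (induction rule: vir.span_induct_alt)
      case (step b y y')
      then obtain j where j: "y = vir_d j" "int r < j" by auto
      have "i \<noteq> - j" using i(2) j(2) by linarith
      then have "vir_bracket (vir_d i) (vir_d j) = pm_scale (*) (of_int (j - i)) (vir_d (i + j))"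
        by (auto simp: vir_bracket_d)
      moreover have "vir_d (i + j) \<in> ?S" using i(2) j(2) by force
      ultimately show ?case
        using step unfolding j(1)
        by (simp add: vir_bracket_add_right vir_bracket_scale_right vir.span_add vir.span_scale vir.span_base)
    qed (simp add: vir.span_zero)
    then show ?case
      using step unfolding i(1)
      by (simp add: vir_bracket_add_left vir_bracket_scale_left vir.span_add vir.span_scale)
  qed (simp add: vir.span_zero)
  moreover have "vir.span ?S \<subseteq> vir.span ?P"
    by (intro vir.span_mono) auto
  ultimately show ?thesis
    by (auto simp: lie_ideal_def lie_subalgebra_def vir_plus_def vir_plus_ideal_eq vir.span_zero
        vir.span_add vir.span_scale)
qed

lemma complex_lie_algebra_vir_plus: "complex_lie_algebra vir_plus"
  unfolding vir_plus_def
  using span_d_subalgebra[of 0]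
  by (intro complex_lie_algebra_subalgebra complex_lie_algebra_virasoro) simp

lemma UN_eq_const:
  assumes "x0 \<in> X" "\<And>x. x \<in> X \<Longrightarrow> F x = c"
  shows "(\<Union>x\<in>X. F x) = c"
  using assms by blast

locale lie_algebra_ideal = complex_lie_algebra L for L :: "('a, 'x) lie_struct_scheme" (structure) +
  fixes I assumes ideal: "lie_ideal L I"
begin

lemma I_sub: "x \<in> I \<Longrightarrow> x \<in> lcarrier L"
  and I_zero: "\<zero> \<in> I"
  and I_add: "x \<in> I \<Longrightarrow> y \<in> I \<Longrightarrow> x \<oplus> y \<in> I"
  and I_smult: "x \<in> I \<Longrightarrow> a \<odot> x \<in> I"
  and I_bracket: "x \<in> lcarrier L \<Longrightarrow> y \<in> I \<Longrightarrow> \<lbrace>x, y\<rbrace> \<in> I"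
  using ideal by (auto simp: lie_ideal_def lie_subalgebra_def)

lemma add_zero_right: "x \<in> lcarrier L \<Longrightarrow> x \<oplus> \<zero> = x"
  using add_commute[of x \<zero>] add_zero[of x] zero_closed by simp

lemma smult_zero: "x \<in> lcarrier L \<Longrightarrow> 0 \<odot> x = \<zero>"
proof -
  assume x: "x \<in> lcarrier L"
  then have c: "0 \<odot> x \<in> lcarrier L" by (rule smult_closed)
  obtain y where y: "y \<in> lcarrier L" "y \<oplus> 0 \<odot> x = \<zero>" using add_inverse[OF c] by auto
  have "0 \<odot> x = (y \<oplus> 0 \<odot> x) \<oplus> 0 \<odot> x" unfolding y(2) by (simp only: add_zero c)
  also have "\<dots> = y \<oplus> (0 \<odot> x \<oplus> 0 \<odot> x)" by (rule add_assoc) (use y c in auto)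
  also have "\<dots> = y \<oplus> 0 \<odot> x" using smult_add_left[OF x, of 0 0] by simp
  finally show ?thesis using y(2) by simp
qed

lemma neg_add: "x \<in> lcarrier L \<Longrightarrow> (-1) \<odot> x \<oplus> x = \<zero>"
  using smult_add_left[of x "-1" 1] smult_zero smult_one by simp

lemma neg_unique:
  assumes "a \<oplus> b = \<zero>" "a \<in> lcarrier L" "b \<in> lcarrier L"
  shows "a = (-1) \<odot> b"
proof -
  have n: "(-1) \<odot> b \<in> lcarrier L" using assms by (simp add: smult_closed)
  have "b \<oplus> (-1) \<odot> b = \<zero>" using neg_add[OF assms(3)] add_commute[OF assms(3) n] by simp
  then have "a = a \<oplus> (b \<oplus> (-1) \<odot> b)" using add_zero_right[OF assms(2)] by simp
  also have "\<dots> = (a \<oplus> b) \<oplus> (-1) \<odot> b" by (rule add_assoc[symmetric]) (use assms n in auto)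
  also have "\<dots> = (-1) \<odot> b" unfolding assms(1) by (rule add_zero[OF n])
  finally show ?thesis .
qed

lemma add_left_commute: "\<lbrakk>x \<in> lcarrier L; y \<in> lcarrier L; z \<in> lcarrier L\<rbrakk>
   \<Longrightarrow> x \<oplus> (y \<oplus> z) = y \<oplus> (x \<oplus> z)"
  by (simp only: add_assoc[symmetric] add_commute[of x y])

lemmas ac = add_assoc add_commute add_left_commute

lemma bracket_I_left: assumes "x \<in> I" "y \<in> lcarrier L" shows "\<lbrace>x, y\<rbrace> \<in> I"
proof -
  note x = I_sub[OF assms(1)]
  have "\<zero> = \<lbrace>x \<oplus> y, x \<oplus> y\<rbrace>" using x assms(2) by (simp add: bracket_self add_closed)
  also have "\<dots> = \<lbrace>x, y\<rbrace> \<oplus> \<lbrace>y, x\<rbrace>"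
    using x assms(2)
    by (subst bracket_add_left)
      (simp_all add: bracket_add_right add_closed bracket_closed bracket_self add_zero add_zero_right)
  finally have *: "\<lbrace>x, y\<rbrace> \<oplus> \<lbrace>y, x\<rbrace> = \<zero>" by simp
  then have "\<lbrace>x, y\<rbrace> = (-1) \<odot> \<lbrace>y, x\<rbrace>"
    by (rule neg_unique) (use x assms(2) bracket_closed in auto)
  then show ?thesis using I_smult I_bracket[OF assms(2,1)] by simp
qed

lemma coset_add_I:
  assumes "x \<in> lcarrier L" "h \<in> I"
  shows "lie_coset L I (x \<oplus> h) = lie_coset L I x"
proof
  show "lie_coset L I (x \<oplus> h) \<subseteq> lie_coset L I x"
    using assms by (auto simp: lie_coset_def add_assoc I_sub intro!: imageI I_add)
  show "lie_coset L I x \<subseteq> lie_coset L I (x \<oplus> h)"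
  proof
    fix z assume "z \<in> lie_coset L I x"
    then obtain k where k: "k \<in> I" "z = x \<oplus> k" by (auto simp: lie_coset_def)
    note h = I_sub[OF assms(2)] and kc = I_sub[OF k(1)]
    have n: "(-1) \<odot> h \<in> lcarrier L" by (rule smult_closed[OF h])
    have "h \<oplus> ((-1) \<odot> h \<oplus> k) = (-1) \<odot> h \<oplus> (h \<oplus> k)"
      by (rule add_left_commute[OF h n kc])
    also have "\<dots> = ((-1) \<odot> h \<oplus> h) \<oplus> k" by (rule add_assoc[OF n h kc, symmetric])
    also have "\<dots> = k" unfolding neg_add[OF h] by (rule add_zero[OF kc])
    finally have "(x \<oplus> h) \<oplus> ((-1) \<odot> h \<oplus> k) = z"
      unfolding k(2) using add_assoc[OF assms(1) h add_closed[OF n kc]] by simp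
    moreover have "(-1) \<odot> h \<oplus> k \<in> I" by (intro I_add I_smult assms k)
    ultimately show "z \<in> lie_coset L I (x \<oplus> h)"
      unfolding lie_coset_def by blast
  qed
qed

lemma self_in_coset: "x \<in> lcarrier L \<Longrightarrow> x \<in> lie_coset L I x"
  unfolding lie_coset_def using I_zero add_zero_right by force

lemma coset_I: "h \<in> I \<Longrightarrow> lie_coset L I h = lie_coset L I \<zero>"
  using coset_add_I[of \<zero> h] by (simp add: zero_closed add_zero I_sub)

lemma quot_add:
  assumes "x \<in> lcarrier L" "y \<in> lcarrier L"
  shows "ladd (lie_quotient L I) (lie_coset L I x) (lie_coset L I y) = lie_coset L I (x \<oplus> y)"
proof -
  have "lie_coset L I (x' \<oplus> y') = lie_coset L I (x \<oplus> y)"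
    if "x' \<in> lie_coset L I x" "y' \<in> lie_coset L I y" for x' y'
  proof -
    from that obtain h k where hk: "h \<in> I" "k \<in> I" "x' = x \<oplus> h" "y' = y \<oplus> k"
      by (auto simp: lie_coset_def)
    have "x' \<oplus> y' = (x \<oplus> y) \<oplus> (h \<oplus> k)"
      using hk assms by (simp add: ac I_sub add_closed)
    then show ?thesis using hk assms by (simp add: coset_add_I add_closed I_add)
  qed
  then show ?thesis
    unfolding lie_quotient_def lie_struct.simps
    by (intro UN_eq_const[OF self_in_coset] assms)
qed

lemma quot_smult:
  assumes "x \<in> lcarrier L"
  shows "lsmult (lie_quotient L I) a (lie_coset L I x) = lie_coset L I (a \<odot> x)"
proof -
  have "lie_coset L I (a \<odot> x') = lie_coset L I (a \<odot> x)"
    if "x' \<in> lie_coset L I x" for x'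
  proof -
    from that obtain h where h: "h \<in> I" "x' = x \<oplus> h"
      by (auto simp: lie_coset_def)
    then show ?thesis
      using assms by (simp add: smult_add_right I_sub coset_add_I smult_closed I_smult)
  qed
  then show ?thesis
    unfolding lie_quotient_def lie_struct.simps
    by (intro UN_eq_const[OF self_in_coset] assms)
qed

lemma quot_bracket:
  assumes "x \<in> lcarrier L" "y \<in> lcarrier L"
  shows "lbracket (lie_quotient L I) (lie_coset L I x) (lie_coset L I y) = lie_coset L I \<lbrace>x, y\<rbrace>"
proof -
  have "lie_coset L I \<lbrace>x', y'\<rbrace> = lie_coset L I \<lbrace>x, y\<rbrace>"
    if "x' \<in> lie_coset L I x" "y' \<in> lie_coset L I y" for x' y'
  proof -
    from that obtain h k where hk: "h \<in> I" "k \<in> I" "x' = x \<oplus> h" "y' = y \<oplus> k"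
      by (auto simp: lie_coset_def)
    have "\<lbrace>x', y'\<rbrace> = \<lbrace>x, y\<rbrace> \<oplus> (\<lbrace>h, y\<rbrace> \<oplus> (\<lbrace>x, k\<rbrace> \<oplus> \<lbrace>h, k\<rbrace>))"
      using hk assms
      by (simp add: bracket_add_left bracket_add_right I_sub add_closed bracket_closed add_assoc)
    then show ?thesis
      using hk assms by (simp add: coset_add_I bracket_closed I_add I_bracket bracket_I_left I_sub)
  qed
  then show ?thesis
    unfolding lie_quotient_def lie_struct.simps
    by (intro UN_eq_const[OF self_in_coset] assms)
qed

lemma quot_sel: "lcarrier (lie_quotient L I) = lie_coset L I ` lcarrier L"
  "lzero (lie_quotient L I) = lie_coset L I \<zero>"
  by (simp_all add: lie_quotient_def)

lemma complex_lie_algebra_quotient: "complex_lie_algebra (lie_quotient L I)"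
proof -
  have inv: "\<exists>y\<in>lcarrier L. lie_coset L I (y \<oplus> x) = lie_coset L I \<zero>" if "x \<in> lcarrier L" for x
    using add_inverse[OF that] by metis
  have assoc: "lie_coset L I ((x \<oplus> y) \<oplus> z) = lie_coset L I (x \<oplus> (y \<oplus> z))"
    if "x \<in> lcarrier L" "y \<in> lcarrier L" "z \<in> lcarrier L" for x y z
    by (simp only: add_assoc that)
  have comm: "lie_coset L I (x \<oplus> y) = lie_coset L I (y \<oplus> x)"
    if "x \<in> lcarrier L" "y \<in> lcarrier L" for x y
    using add_commute[OF that] by simp
  note closed = zero_closed add_closed smult_closed bracket_closed
  note quot = quot_add quot_smult quot_bracket
  show ?thesis
    by unfold_locales
      (unfold quot_sel, auto simp: quot closed add_zero smult_add_right smult_add_left smult_smult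
        smult_one inv bracket_add_left bracket_add_right bracket_smult_left bracket_smult_right
        bracket_self jacobi assoc, auto simp: comm)
qed

end

lemma lie_algebra_ideal_vir_plus: "lie_algebra_ideal vir_plus (vir_plus_ideal r)"
  by (intro lie_algebra_ideal.intro complex_lie_algebra_vir_plus lie_algebra_ideal_axioms.intro
      lie_ideal_vir_plus)

lemma complex_lie_algebra_a_alg: "complex_lie_algebra (a_alg r)"
  unfolding a_alg_def
  by (rule lie_algebra_ideal.complex_lie_algebra_quotient[OF lie_algebra_ideal_vir_plus])

lemma dbar_closed: "dbar r i \<in> lcarrier (a_alg r)"
  by (auto simp: dbar_def a_alg_def lie_quotient_def vir_plus_def intro!: imageI vir.span_base)

lemma dbar_eq_zero: assumes "r < i" shows "dbar r i = lzero (a_alg r)"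
proof -
  interpret lie_algebra_ideal vir_plus "vir_plus_ideal r" by (rule lie_algebra_ideal_vir_plus)
  have "vir_d (int i) \<in> vir_plus_ideal r"
    using assms unfolding vir_plus_ideal_eq by (intro vir.span_base) auto
  then show ?thesis by (simp add: dbar_def a_alg_def quot_sel coset_I)
qed

lemma dbar_bracket:
  "lbracket (a_alg r) (dbar r i) (dbar r j) = lsmult (a_alg r) (of_int (int j - int i)) (dbar r (i + j))"
proof -
  interpret lie_algebra_ideal vir_plus "vir_plus_ideal r" by (rule lie_algebra_ideal_vir_plus)
  have d: "vir_d (int i) \<in> lcarrier vir_plus" for i
    by (auto simp: vir_plus_def intro!: vir.span_base)
  have "vir_bracket (vir_d (int i)) (vir_d (int j)) =
      pm_scale (*) (of_int (int j - int i)) (vir_d (int (i + j)))"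
  proof -
    have *: "int i ^ 3 - int i = 0" if "int i = - int j"
    proof -
      have "i = 0" using that by linarith
      then show ?thesis by simp
    qed
    show ?thesis
      unfolding vir_bracket_d using * by (cases "int i = - int j") (simp_all only: if_True if_False of_int_0 div_0 vir.scale_zero_left add_0_right of_nat_add refl)
  qed
  then have "lbracket vir_plus (vir_d (int i)) (vir_d (int j)) =
      lsmult vir_plus (of_int (int j - int i)) (vir_d (int (i + j)))"
    by (simp add: vir_plus_def)
  then show ?thesis
    unfolding dbar_def a_alg_def using d by (simp only: quot_bracket quot_smult)
qed


section \<open>\<open>N(M, \<alpha>)\<close> is a weight module over the Virasoro algebra\<close>

lemma binomial_weight_identity:
  fixes m k :: complex
  shows "(\<Sum>i\<le>N. (of_nat (N - i) - of_nat i) * (m ^ i / fact i) * (k ^ (N - i) / fact (N - i)))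
    = (if N = 0 then 0 else (k - m) * (m + k) ^ (N - 1) / fact (N - 1))"
proof (cases N)
  case (Suc n)
  define f where "f = (\<lambda>i. (m ^ i / fact i) * (k ^ (N - i) / fact (N - i)))"
  have binom: "(\<Sum>i\<le>n. (m ^ i / fact i) * (k ^ (n - i) / fact (n - i))) = (m + k) ^ n / fact n"
    unfolding binomial_ring sum_divide_distrib
    by (rule sum.cong) (auto simp: binomial_fact)
  have "(\<Sum>i\<le>N. of_nat i * f i) = (\<Sum>i\<le>n. of_nat (Suc i) * f (Suc i))"
    unfolding Suc by (simp only: sum.atMost_Suc_shift) simp
  also have "\<dots> = m * (\<Sum>i\<le>n. (m ^ i / fact i) * (k ^ (n - i) / fact (n - i)))"
    unfolding sum_distrib_left f_def Suc
    by (rule sum.cong) (simp_all add: field_simps del: of_nat_Suc)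
  finally have 1: "(\<Sum>i\<le>N. of_nat i * f i) = m * (m + k) ^ n / fact n"
    unfolding binom by simp
  have "(\<Sum>i\<le>N. of_nat (N - i) * f i) = (\<Sum>i\<le>n. of_nat (N - i) * f i)"
    unfolding Suc by simp
  also have "\<dots> = k * (\<Sum>i\<le>n. (m ^ i / fact i) * (k ^ (n - i) / fact (n - i)))"
    unfolding sum_distrib_left f_def Suc
    by (rule sum.cong) (auto simp: Suc_diff_le field_simps simp del: of_nat_Suc)
  finally have 2: "(\<Sum>i\<le>N. of_nat (N - i) * f i) = k * (m + k) ^ n / fact n"
    unfolding binom by simp
  have "(\<Sum>i\<le>N. (of_nat (N - i) - of_nat i) * (m ^ i / fact i) * (k ^ (N - i) / fact (N - i)))
     = (\<Sum>i\<le>N. of_nat (N - i) * f i) - (\<Sum>i\<le>N. of_nat i * f i)"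
    by (simp only: f_def left_diff_distrib sum_subtractf mult.assoc)
  then show ?thesis
    unfolding 1 2 using Suc by (simp add: diff_divide_distrib left_diff_distrib)
qed simp

lemma binomial_weight_identity':
  fixes m k :: complex
  shows "(\<Sum>i\<le>l. (of_nat (l - i) - of_nat i) * (m ^ (i + 1) / fact (i + 1)) * (k ^ (l - i + 1) / fact (l - i + 1)))
    = ((k - m) * (m + k) ^ (l + 1) - k * k ^ (l + 1) + m * m ^ (l + 1)) / fact (l + 1)"
proof -
  define g where "g = (\<lambda>i. (of_nat (Suc (Suc l) - i) - of_nat i) * (m ^ i / fact i) *
    (k ^ (Suc (Suc l) - i) / fact (Suc (Suc l) - i)))"
  have "sum g {..Suc (Suc l)} = g 0 + (\<Sum>i\<le>l. g (Suc i)) + g (Suc (Suc l))"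
    by (simp only: sum.atMost_Suc_shift[of g "Suc l"]) (simp add: add.assoc)
  moreover have "sum g {..Suc (Suc l)} = (k - m) * (m + k) ^ (l + 1) / fact (l + 1)"
    unfolding g_def binomial_weight_identity by simp
  moreover have "g 0 = k * k ^ (l + 1) / fact (l + 1)"
    unfolding g_def by (simp add: divide_simps del: of_nat_Suc)
  moreover have "g (Suc (Suc l)) = - (m * m ^ (l + 1) / fact (l + 1))"
    unfolding g_def by (simp add: divide_simps del: of_nat_Suc)
  moreover have "(\<Sum>i\<le>l. g (Suc i)) = (\<Sum>i\<le>l. (of_nat (l - i) - of_nat i) * (m ^ (i + 1) / fact (i + 1)) * (k ^ (l - i + 1) / fact (l - i + 1)))"
    by (rule sum.cong) (auto simp: g_def Suc_diff_le)
  ultimately show ?thesis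
    by (simp add: add_divide_distrib diff_divide_distrib algebra_simps)
qed

locale a_module =
  fixes r :: nat and scale :: "complex \<Rightarrow> 'm::ab_group_add \<Rightarrow> 'm" and act :: "vir set \<Rightarrow> 'm \<Rightarrow> 'm"
    and \<alpha> :: complex
  assumes lie_module: "lie_module (a_alg r) scale act"
begin

sublocale lie_module "a_alg r" scale act by (rule lie_module)

lemma vs: "vector_space scale" by (rule vector_space_axioms)

lemma vsN: "vector_space (N_scale scale :: complex \<Rightarrow> (int \<Rightarrow>\<^sub>0 'm) \<Rightarrow> _)"
  unfolding N_scale_def by (rule vector_space_pm_scale[OF vs])

sublocale N: vector_space "N_scale scale :: complex \<Rightarrow> (int \<Rightarrow>\<^sub>0 'm) \<Rightarrow> _" by (rule vsN)

abbreviation A where "A i \<equiv> act (dbar r i)"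

definition S where "S m v = (\<Sum>i\<le>r. scale (of_int m ^ (i + 1) / fact (i + 1)) (A i v))"

lemma A_add: "A i (v + w) = A i v + A i w" and A_scale: "A i (scale a v) = scale a (A i v)"
  using act_add_right act_scale_right dbar_closed by auto

lemma A_zero [simp]: "A i 0 = 0" using A_add[of i 0 0] by simp

lemma A_sum: "A i (sum f X) = (\<Sum>x\<in>X. A i (f x))"
  by (induction X rule: infinite_finite_induct) (auto simp: A_add)

lemma S_add: "S m (v + w) = S m v + S m w"
  by (simp add: S_def A_add scale_right_distrib sum.distrib)

lemma S_scale: "S m (scale a v) = scale a (S m v)"
  by (simp add: S_def A_scale scale_sum_right mult.commute)

lemma A_high: assumes "r < i" shows "A i v = 0"
proof -
  have z: "\<zero>\<^bsub>a_alg r\<^esub> \<oplus>\<^bsub>a_alg r\<^esub> \<zero>\<^bsub>a_alg r\<^esub> = \<zero>\<^bsub>a_alg r\<^esub>"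
    by (rule add_zero[OF zero_closed])
  have "act \<zero>\<^bsub>a_alg r\<^esub> v = act \<zero>\<^bsub>a_alg r\<^esub> v + act \<zero>\<^bsub>a_alg r\<^esub> v"
    using act_add_left[OF zero_closed zero_closed, of v] z by simp
  then show ?thesis using dbar_eq_zero[OF assms] by simp
qed

lemma A_comm: "A i (A j v) - A j (A i v) = scale (of_int (int j - int i)) (A (i + j) v)"
  using act_bracket[OF dbar_closed[of r i] dbar_closed[of r j], of v]
    act_smult_left[OF dbar_closed[of r "i + j"], of "of_int (int j - int i)" v]
  by (simp add: dbar_bracket)

lemma S_comm:
  "S m (S k v) - S k (S m v) =
     scale (of_int (k - m)) (S (m + k) v) - scale (of_int k) (S k v) + scale (of_int m) (S m v)"
proof -
  define c :: "int \<Rightarrow> nat \<Rightarrow> complex" where "c = (\<lambda>m i. of_int m ^ (i + 1) / fact (i + 1))"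
  define h where "h = (\<lambda>i j. scale (of_int (int j - int i) * c m i * c k j) (A (i + j) v))"
  have "S m (S k v) = (\<Sum>i\<le>r. \<Sum>j\<le>r. scale (c m i * c k j) (A i (A j v)))"
    by (simp add: S_def c_def A_sum A_scale scale_sum_right)
  moreover have "S k (S m v) = (\<Sum>i\<le>r. \<Sum>j\<le>r. scale (c m i * c k j) (A j (A i v)))"
    by (subst sum.swap) (simp add: S_def c_def A_sum A_scale scale_sum_right mult.commute)
  ultimately have "S m (S k v) - S k (S m v) =
      (\<Sum>i\<le>r. \<Sum>j\<le>r. scale (c m i * c k j) (A i (A j v) - A j (A i v)))"
    by (simp add: sum_subtractf scale_right_diff_distrib)
  also have "\<dots> = (\<Sum>i\<le>r. \<Sum>j\<le>r. h i j)"
    by (simp add: A_comm h_def mult_ac)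
  also have "\<dots> = (\<Sum>(i, j)\<in>{..r} \<times> {..r}. h i j)"
    by (simp add: sum.cartesian_product)
  also have "\<dots> = (\<Sum>(i, j)\<in>{(i, j). i + j \<le> r}. h i j)"
    by (rule sum.mono_neutral_right) (use A_high in \<open>force simp: h_def not_le[symmetric]\<close>)+
  also have "\<dots> = (\<Sum>l\<le>r. \<Sum>i\<le>l. h i (l - i))"
    by (rule sum.triangle_reindex_eq)
  also have "\<dots> = (\<Sum>l\<le>r. scale (\<Sum>i\<le>l. (of_nat (l - i) - of_nat i) * c m i * c k (l - i)) (A l v))"
    by (auto simp: h_def scale_sum_left intro!: sum.cong)
  also have "\<dots> = (\<Sum>l\<le>r. scale (of_int (k - m) * c (m + k) l - of_int k * c k l + of_int m * c m l) (A l v))"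
    unfolding c_def binomial_weight_identity'
    by (simp add: add_divide_distrib diff_divide_distrib)
  also have "\<dots> = scale (of_int (k - m)) (S (m + k) v) - scale (of_int k) (S k v) + scale (of_int m) (S m v)"
    by (simp only: S_def c_def[symmetric] fun_cong[OF fun_cong[OF c_def], symmetric] scale_sum_right scale_scale sum.distrib
        scale_left_distrib scale_left_diff_distrib sum_subtractf)
  finally show ?thesis .
qed

abbreviation coeff where "coeff \<equiv> N_coeff r scale act \<alpha>"
abbreviation Nb where "Nb \<equiv> N_basis r scale act \<alpha>"
abbreviation Na where "Na \<equiv> N_act r scale act \<alpha>"

lemma coeff_eq: "coeff m n v = scale (\<alpha> + of_int n) v + S m v"
  by (simp add: N_coeff_def S_def)

lemma coeff_add: "coeff m n (v + w) = coeff m n v + coeff m n w"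
  by (simp add: coeff_eq S_add scale_right_distrib)

lemma coeff_scale: "coeff m n (scale a v) = scale a (coeff m n v)"
  by (simp add: coeff_eq S_scale scale_right_distrib mult.commute)

lemma coeff_zero [simp]: "coeff m n 0 = 0"
  using coeff_add[of m n 0 0] by simp

lemma coeff_comm:
  "coeff m (n + k) (coeff k n v) - coeff k (n + m) (coeff m n v) = scale (of_int (k - m)) (coeff (m + k) n v)"
proof -
  have "coeff m (n + k) (coeff k n v) - coeff k (n + m) (coeff m n v) =
     (S m (S k v) - S k (S m v)) + scale (of_int (k - m)) (scale (\<alpha> + of_int n) v)
     + scale (of_int k) (S k v) - scale (of_int m) (S m v)"
    by (simp add: coeff_eq S_add S_scale scale_right_distrib scale_left_distrib
        scale_left_diff_distrib algebra_simps)
  also have "\<dots> = scale (of_int (k - m)) (coeff (m + k) n v)"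
    unfolding S_comm coeff_eq by (simp add: scale_right_distrib)
  finally show ?thesis .
qed

lemma Nb_superset:
  assumes "finite X" "Poly_Mapping.keys f \<subseteq> X"
  shows "Nb (D m) f = (\<Sum>n\<in>X. Poly_Mapping.single (n + m) (coeff m n (Poly_Mapping.lookup f n)))"
  unfolding N_basis.simps
  by (rule sum.mono_neutral_left) (use assms in \<open>auto simp: in_keys_iff\<close>)

lemma Nb_add: "Nb p (f + g) = Nb p f + Nb p g"
proof (cases p)
  case (D m)
  let ?X = "Poly_Mapping.keys f \<union> Poly_Mapping.keys g"
  have "Nb (D m) h = (\<Sum>n\<in>?X. Poly_Mapping.single (n + m) (coeff m n (Poly_Mapping.lookup h n)))"
    if "Poly_Mapping.keys h \<subseteq> ?X" for h
    using that by (intro Nb_superset) auto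
  then show ?thesis
    unfolding D using Poly_Mapping.keys_add[of f g]
    by (simp add: lookup_add coeff_add single_add sum.distrib del: N_basis.simps)
qed simp

lemma N_scale_single: "N_scale scale a (Poly_Mapping.single n v) = Poly_Mapping.single n (scale a v)"
  by (simp add: N_scale_def pm_scale_single)

lemma lookup_N_scale: "Poly_Mapping.lookup (N_scale scale a f) n = scale a (Poly_Mapping.lookup f n)"
  by (simp add: N_scale_def lookup_pm_scale)

lemma Nb_scale: "Nb p (N_scale scale a f) = N_scale scale a (Nb p f)"
proof (cases p)
  case (D m)
  have "Nb (D m) (N_scale scale a f) =
     (\<Sum>n\<in>Poly_Mapping.keys f. Poly_Mapping.single (n + m) (coeff m n (Poly_Mapping.lookup (N_scale scale a f) n)))"
    by (rule Nb_superset) (auto simp: in_keys_iff lookup_N_scale)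
  then show ?thesis
    unfolding D by (simp add: lookup_N_scale coeff_scale N.scale_sum_right N_scale_single)
qed simp

lemma Nb_single: "Nb (D m) (Poly_Mapping.single n v) = Poly_Mapping.single (n + m) (coeff m n v)"
  by (subst Nb_superset[of "{n}"]) auto

lemma Na_add_right: "Na x (f + g) = Na x f + Na x g"
  by (simp add: N_act_def Nb_add lin_ext_fun_add[OF vsN])

lemma Na_scale_right: "Na x (N_scale scale a f) = N_scale scale a (Na x f)"
  by (simp add: N_act_def Nb_scale lin_ext_fun_scale[OF vsN])

lemma Na_add_left: "Na (x + y) f = Na x f + Na y f"
  by (simp add: N_act_def lin_ext_add[OF vsN])

lemma Na_scale_left: "Na (pm_scale (*) a x) f = N_scale scale a (Na x f)"
  by (simp add: N_act_def lin_ext_scale[OF vsN])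

lemma Na_zero [simp]: "Na 0 f = 0" "Na x 0 = 0"
  using Na_add_left[of 0 0] Na_add_right[of x 0 0] by auto

lemma Na_basis: "Na (Poly_Mapping.single p a) f = N_scale scale a (Nb p f)"
  by (simp add: N_act_def lin_ext_single[OF vsN])

lemma Na_d: "Na (vir_d m) (Poly_Mapping.single n v) = Poly_Mapping.single (n + m) (coeff m n v)"
  by (simp add: vir_d_def Na_basis Nb_single del: N_basis.simps(1))

lemma Na_c: "Na vir_c f = 0"
  by (simp add: vir_c_def Na_basis)

lemma Nb_zero [simp]: "Nb p 0 = 0"
  using Nb_add[of p 0 0] by simp

lemma Na_bracket_basis:
  "Na (basis_bracket p q) (Poly_Mapping.single n v) =
     Nb p (Nb q (Poly_Mapping.single n v)) - Nb q (Nb p (Poly_Mapping.single n v))"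
proof (cases p; cases q)
  fix m k assume "p = D m" "q = D k"
  moreover have "Na (if P then Poly_Mapping.single C a else 0) f = 0" for P a f
    by (simp add: Na_basis)
  moreover have "n + k + m = n + (m + k)" "n + m + k = n + (m + k)" by simp_all
  ultimately show ?thesis
    by (simp only: basis_bracket.simps Na_add_left Na_basis Nb_single N_scale_single add_0_right
      coeff_comm[symmetric] single_diff)
qed (auto simp: Nb_single Na_basis simp del: N_basis.simps(1))

lemma Na_bracket: "Na (vir_bracket x y) f = Na x (Na y f) - Na y (Na x f)"
proof (induction x rule: poly_mapping_add_induct)
  case x: (single p a)
  show ?case
  proof (induction y rule: poly_mapping_add_induct)
    case y: (single q b)
    show ?case
    proof (induction f rule: poly_mapping_add_induct)
      case (single n v)
      show ?case
        by (simp add: vir_bracket_single Na_scale_left Na_bracket_basis Na_basis Nb_scale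
            N.scale_right_diff_distrib mult.commute del: N_basis.simps)
    qed (simp_all add: Na_add_right)
  qed (simp_all add: vir_bracket_add_right Na_add_left Na_add_right)
qed (simp_all add: vir_bracket_add_left Na_add_left Na_add_right)

lemma lie_module_N: "lie_module virasoro (N_scale scale) Na"
  by (intro lie_module.intro complex_lie_algebra_virasoro vsN lie_module_axioms.intro)
    (simp_all add: Na_add_right Na_scale_right Na_add_left Na_scale_left Na_bracket)

lemma coeff_0: "coeff 0 n v = scale (\<alpha> + of_int n) v"
  by (simp add: N_coeff_def)

lemma weight_module_N: "weight_module (N_scale scale) Na"
proof -
  have "f \<in> N.span {v. \<exists>a. Na (vir_d 0) v = N_scale scale a v}" for f
  proof (induction f rule: poly_mapping_add_induct)
    case (single n v)
    have "Na (vir_d 0) (Poly_Mapping.single n v) = N_scale scale (\<alpha> + of_int n) (Poly_Mapping.single n v)"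
      by (simp add: Na_d coeff_0 N_scale_single)
    then show ?case by (intro N.span_base) auto
  qed (auto intro: N.span_zero N.span_add)
  then show ?thesis unfolding weight_module_def using lie_module_N by auto
qed

end

lemma weight_module_N_act:
  assumes "lie_module (a_alg r) scale act"
  shows "weight_module (N_scale scale) (N_act r scale act \<alpha>)"
  using a_module.weight_module_N[OF a_module.intro[OF assms]] .

lemma N_act_vir_d:
  assumes "lie_module (a_alg r) scale act"
  shows "N_act r scale act \<alpha> (vir_d m) (Poly_Mapping.single n v) =
    Poly_Mapping.single (n + m) (scale (\<alpha> + of_int n) v +
      (\<Sum>i\<le>r. scale (of_int m ^ (i + 1) / fact (i + 1)) (act (dbar r i) v)))"
  using a_module.Na_d[OF a_module.intro[OF assms]] by (simp only: N_coeff_def)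

lemma N_act_vir_c:
  assumes "lie_module (a_alg r) scale act"
  shows "N_act r scale act \<alpha> vir_c f = 0"
  using a_module.Na_c[OF a_module.intro[OF assms]] .

end

theory Submission
  imports Defs "HOL-Computational_Algebra.Polynomial"
begin

text \<open>
  Write \<open>A\<^sub>i\<close> for the action of \<open>dbar r i\<close> on \<open>M\<close>, and let \<open>W\<close> be a nonzero submodule of
  \<open>N(M, \<alpha>)\<close>. Since \<open>d\<^sub>0\<close> acts by distinct scalars on the spaces \<open>M \<otimes> t\<^sup>n\<close>, \<open>W\<close> is the direct sum of
  \<open>W\<^sub>n \<otimes> t\<^sup>n\<close> for subspaces \<open>W\<^sub>n\<close> of \<open>M\<close>, its slices (\<open>single_lookup_mem\<close>). Information on the
  slices comes from the fact that \<open>d\<^sub>m\<close> depends polynomially on \<open>m\<close>: if a vector-valued polynomial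
  takes values in a subspace at all integers \<open>m\<close>, then its coefficients lie in that subspace
  (\<open>power_coefficients_mem\<close>).

  Fix \<open>n\<close> and \<open>k\<close>. For every \<open>m\<close> the product \<open>d\<^sub>m d\<^bsub>k-m\<^esub>\<close> maps \<open>W\<^sub>n\<close> to \<open>W\<^bsub>n+k\<^esub>\<close>, and it acts on \<open>W\<^sub>n\<close> by
  the operator
  \<open>(\<alpha> + n + k - m + (\<Sum>i\<le>r. m\<^bsup>i+1\<^esup>/(i+1)! A\<^sub>i)) (\<alpha> + n + (\<Sum>j\<le>r. (k-m)\<^bsup>j+1\<^esup>/(j+1)! A\<^sub>j))\<close>.
  Its degree in \<open>m\<close> is at most \<open>2r+2\<close>, and the coefficient of \<open>m\<^bsup>2r+2\<^esup>\<close> is a nonzero multiple of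
  \<open>A\<^sub>r A\<^sub>r\<close>. This is where \<open>r \<ge> 1\<close> enters: for \<open>r = 0\<close> the summand \<open>-m\<close> of the first factor would
  contribute to the top coefficient too. Hence \<open>A\<^sub>r A\<^sub>r\<close> maps every slice into the intersection of
  all slices (\<open>top_square_mem_slice\<close>), and this intersection is nonzero because \<open>A\<^sub>r\<close> is injective.

  The intersection is moreover a submodule of \<open>M\<close> (\<open>A_mem_Inter_slices\<close>,
  \<open>submodule_Inter_slices\<close>): if \<open>v\<close> lies in all slices, then for fixed \<open>l\<close> the elements
  \<open>d\<^sub>m (v \<otimes> t\<^bsup>l-m\<^esup>)\<close> all lie in \<open>W\<^sub>l \<otimes> t\<^sup>l\<close>, and the coefficients of this polynomial in \<open>m\<close> show that
  \<open>A\<^sub>i v \<in> W\<^sub>l\<close> for all \<open>i\<close>. Since \<open>M\<close> is simple, the intersection is \<open>M\<close>, so \<open>W\<close> is everything.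
\<close>


section \<open>Polynomials with coefficients in a vector space\<close>

text \<open>Comparing the values at \<open>2m\<close> and \<open>m\<close> eliminates the top coefficient: the polynomial
  \<open>f (2m) - 2\<^sup>N f m\<close> has degree below \<open>N\<close>, and its coefficients at \<open>i < N\<close> are those of \<open>f\<close> multiplied
  by \<open>2\<^sup>i - 2\<^sup>N \<noteq> 0\<close>.\<close>

lemma power_coefficients_mem:
  fixes scale :: "'a::field_char_0 \<Rightarrow> 'm::ab_group_add \<Rightarrow> 'm"
  assumes "vector_space scale" and "module.subspace scale U"
    and "\<And>m::int. (\<Sum>i\<le>N. scale (of_int m ^ i) (c i)) \<in> U" and "i \<le> N"
  shows "c i \<in> U"
proof -
  interpret vector_space scale by fact
  note U = \<open>subspace U\<close>
  show ?thesis
    using assms(3,4)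
  proof (induction N arbitrary: c i)
    case 0
    show ?case using 0(1)[of 0] 0(2) by simp
  next
    case (Suc N)
    define f where "f m = (\<Sum>i\<le>Suc N. scale (of_int m ^ i) (c i))" for m :: int
    have lower: "c i \<in> U" if i: "i \<le> N" for i
    proof -
      have "f (2 * m) - scale (2 ^ Suc N) (f m) =
          (\<Sum>i\<le>Suc N. scale (of_int m ^ i) (scale (2 ^ i - 2 ^ Suc N) (c i)))" for m
        unfolding f_def scale_sum_right sum_subtractf[symmetric]
        by (intro sum.cong refl)
          (simp add: power_mult_distrib right_diff_distrib mult.commute
            del: power_Suc flip: scale_left_diff_distrib)
      then have "(\<Sum>i\<le>N. scale (of_int m ^ i) (scale (2 ^ i - 2 ^ Suc N) (c i))) =
          f (2 * m) - scale (2 ^ Suc N) (f m)" for m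
        by simp
      moreover have "f m \<in> U" for m
        unfolding f_def by (rule Suc.prems(1))
      ultimately have "scale (2 ^ i - 2 ^ Suc N) (c i) \<in> U"
        by (intro Suc.IH[of "\<lambda>i. scale (2 ^ i - 2 ^ Suc N) (c i)" i] i)
          (simp only: subspace_diff subspace_scale U)
      then have "scale (inverse (2 ^ i - 2 ^ Suc N)) (scale (2 ^ i - 2 ^ Suc N) (c i)) \<in> U"
        by (rule subspace_scale[OF U])
      moreover have "(2 ^ i - 2 ^ Suc N :: 'a) \<noteq> 0"
      proof -
        have "(2::nat) ^ i \<noteq> 2 ^ Suc N"
          using i power_inject_exp[of "2::nat" i "Suc N"] by linarith
        then have "of_nat (2 ^ i) \<noteq> (of_nat (2 ^ Suc N) :: 'a)"
          unfolding of_nat_eq_iff .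
        then show ?thesis
          unfolding of_nat_power of_nat_numeral right_minus_eq .
      qed
      ultimately show ?thesis by simp
    qed
    have "(\<Sum>i\<le>Suc N. scale (of_int 1 ^ i) (c i)) - (\<Sum>i\<le>N. c i) \<in> U"
      by (intro subspace_diff subspace_sum U Suc.prems(1) lower) auto
    then have "c (Suc N) \<in> U" by simp
    with lower Suc.prems(2) show ?case by (cases "i = Suc N") auto
  qed
qed

lemma poly_coefficients_mem:
  fixes scale :: "'a::field_char_0 \<Rightarrow> 'm::ab_group_add \<Rightarrow> 'm"
  assumes "vector_space scale" and "module.subspace scale U"
    and deg: "\<And>j. j \<in> J \<Longrightarrow> degree (p j) \<le> N"
    and mem: "\<And>m::int. (\<Sum>j\<in>J. scale (poly (p j) (of_int m)) (u j)) \<in> U" and "i \<le> N"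
  shows "(\<Sum>j\<in>J. scale (coeff (p j) i) (u j)) \<in> U"
proof (rule power_coefficients_mem[OF assms(1,2) _ \<open>i \<le> N\<close>])
  interpret vector_space scale by fact
  fix m :: int
  have "(\<Sum>j\<in>J. scale (poly (p j) (of_int m)) (u j)) =
      (\<Sum>j\<in>J. \<Sum>i\<le>N. scale (of_int m ^ i) (scale (coeff (p j) i) (u j)))"
  proof (intro sum.cong refl)
    fix j assume "j \<in> J"
    then have "poly (p j) (of_int m) = (\<Sum>i\<le>N. of_int m ^ i * coeff (p j) i)"
      unfolding poly_altdef using deg
      by (intro sum.mono_neutral_cong_left) (auto simp: coeff_eq_0)
    then show "scale (poly (p j) (of_int m)) (u j) =
        (\<Sum>i\<le>N. scale (of_int m ^ i) (scale (coeff (p j) i) (u j)))"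
      by (simp add: scale_sum_left)
  qed
  also have "\<dots> = (\<Sum>i\<le>N. scale (of_int m ^ i) (\<Sum>j\<in>J. scale (coeff (p j) i) (u j)))"
    by (subst sum.swap) (simp add: scale_sum_right)
  finally show "(\<Sum>i\<le>N. scale (of_int m ^ i) (\<Sum>j\<in>J. scale (coeff (p j) i) (u j))) \<in> U"
    using mem[of m] by simp
qed

lemma monom_linear_power_coeff:
  fixes a :: "'a::idom"
  shows "degree (monom 1 i * [:a, -1:] ^ j) \<le> i + j"
    and "i + j < N \<Longrightarrow> coeff (monom 1 i * [:a, -1:] ^ j) N = 0"
    and "coeff (monom 1 i * [:a, -1:] ^ j) (i + j) = (-1) ^ j"
proof -
  have deg: "degree ([:a, -1:] ^ j) = j" by (simp add: degree_power_eq)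
  show 1: "degree (monom 1 i * [:a, -1:] ^ j) \<le> i + j"
    using degree_mult_le[of "monom 1 i" "[:a, -1:] ^ j"] deg by (simp add: degree_monom_eq)
  show "i + j < N \<Longrightarrow> coeff (monom 1 i * [:a, -1:] ^ j) N = 0"
    using 1 by (intro coeff_eq_0) simp
  show "coeff (monom 1 i * [:a, -1:] ^ j) (i + j) = (-1) ^ j"
    using lead_coeff_power[of "[:a, -1:]" j] deg by (simp add: coeff_monom_mult)
qed


section \<open>The grading of a submodule\<close>

context a_module
begin

definition slice :: "(int \<Rightarrow>\<^sub>0 'm) set \<Rightarrow> int \<Rightarrow> 'm set" where
  "slice W n = {v. Poly_Mapping.single n v \<in> W}"

lemma subspace_slice:
  assumes "N.subspace W"
  shows "subspace (slice W n)"
  using assms N.subspace_0 N.subspace_add N.subspace_scale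
  by (auto simp: slice_def subspace_def single_add simp flip: N_scale_single)

lemma coeff_mem_slice:
  assumes "lie_submodule virasoro (N_scale scale) Na W" and "v \<in> slice W n"
  shows "coeff m n v \<in> slice W (n + m)"
  using assms by (auto simp: slice_def lie_submodule_def simp flip: Na_d)

lemma lookup_Na_d0:
  "Poly_Mapping.lookup (Na (vir_d 0) f) n = scale (\<alpha> + of_int n) (Poly_Mapping.lookup f n)"
proof (induction f rule: poly_mapping_add_induct)
  case (single k v)
  show ?case by (simp add: Na_d coeff_0 lookup_single when_def)
qed (simp_all add: Na_add_right lookup_add scale_right_distrib)

text \<open>The scalars by which \<open>d\<^sub>0\<close> acts on the spaces \<open>M \<otimes> t\<^sup>n\<close> are pairwise distinct, so
  \<open>d\<^sub>0 - (\<alpha> + n)\<close> removes the component of degree \<open>n\<close> and rescales the others by nonzero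
  factors.\<close>

lemma single_lookup_mem:
  assumes W: "lie_submodule virasoro (N_scale scale) Na W" and "f \<in> W"
  shows "Poly_Mapping.single n (Poly_Mapping.lookup f n) \<in> W"
proof -
  have d0: "Na (vir_d 0) g \<in> W" if "g \<in> W" for g
    using W that by (auto simp: lie_submodule_def)
  have sub: "N.subspace W" using W by (simp add: lie_submodule_def)
  have "\<forall>n. Poly_Mapping.single n (Poly_Mapping.lookup f n) \<in> W"
    if "finite X" "Poly_Mapping.keys f \<subseteq> X" "f \<in> W" for X f
    using that
  proof (induction X arbitrary: f rule: finite_induct)
    case empty
    then show ?case using N.subspace_0[OF sub] by simp
  next
    case (insert k X)
    define g where "g = Na (vir_d 0) f - N_scale scale (\<alpha> + of_int k) f"
    have g: "Poly_Mapping.lookup g n = scale (of_int (n - k)) (Poly_Mapping.lookup f n)" for n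
      by (simp add: g_def lookup_minus lookup_Na_d0 lookup_N_scale
          flip: scale_left_diff_distrib)
    have "g \<in> W"
      unfolding g_def by (intro N.subspace_diff N.subspace_scale sub d0 insert.prems)
    moreover have "Poly_Mapping.keys g \<subseteq> X"
      using insert.prems(1) by (auto simp: in_keys_iff g)
    ultimately have g_mem: "Poly_Mapping.single n (Poly_Mapping.lookup g n) \<in> W" for n
      using insert.IH by blast
    have other: "Poly_Mapping.single n (Poly_Mapping.lookup f n) \<in> W" if "n \<noteq> k" for n
    proof -
      have "(of_int (n - k) :: complex) \<noteq> 0" using that by (simp only: of_int_eq_0_iff)
      then have "Poly_Mapping.lookup f n = scale (inverse (of_int (n - k))) (Poly_Mapping.lookup g n)"
        by (simp add: g)
      then show ?thesis
        using N.subspace_scale[OF sub g_mem] by (simp flip: N_scale_single)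
    qed
    have "f = (\<Sum>n\<in>insert k X. Poly_Mapping.single n (Poly_Mapping.lookup f n))"
      using insert.hyps(1) insert.prems(1) poly_mapping_sum_single[of f]
      by (subst (asm) sum.mono_neutral_left[of "insert k X"]) (auto simp: in_keys_iff)
    then have "Poly_Mapping.single k (Poly_Mapping.lookup f k) =
        f - (\<Sum>n\<in>X. Poly_Mapping.single n (Poly_Mapping.lookup f n))"
      using insert.hyps by (simp add: eq_diff_eq)
    also have "\<dots> \<in> W"
      using insert.hyps insert.prems by (intro N.subspace_diff N.subspace_sum sub other) auto
    finally show ?case using other by (metis (full_types))
  qed
  then show ?thesis using finite_keys \<open>f \<in> W\<close> by (metis order_refl)
qed


section \<open>The action as a polynomial in the index\<close>

text \<open>The coefficient of \<open>m\<^sup>i\<close> in the operator by which \<open>d\<^sub>m\<close> acts on \<open>M \<otimes> t\<^sup>n\<close>, where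
  \<open>z = \<alpha> + n\<close>.\<close>

definition pcoeff :: "complex \<Rightarrow> nat \<Rightarrow> 'm \<Rightarrow> 'm" where
  "pcoeff z i v = (case i of 0 \<Rightarrow> scale z v | Suc j \<Rightarrow> scale (1 / fact (Suc j)) (A j v))"

text \<open>The same for the operator by which \<open>d\<^sub>m\<close> maps \<open>M \<otimes> t\<^bsup>l-m\<^esup>\<close> to \<open>M \<otimes> t\<^sup>l\<close>, where \<open>z = \<alpha> + l\<close>:
  keeping the target degree fixed makes the scalar \<open>\<alpha> + (l - m)\<close> depend on \<open>m\<close>.\<close>

definition pcoeff_into :: "complex \<Rightarrow> nat \<Rightarrow> 'm \<Rightarrow> 'm" where
  "pcoeff_into z i v = pcoeff z i v - (if i = 1 then v else 0)"

lemma pcoeff_into_add: "pcoeff_into z i (v + w) = pcoeff_into z i v + pcoeff_into z i w"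
  by (cases i) (simp_all add: pcoeff_into_def pcoeff_def A_add scale_right_distrib)

lemma pcoeff_into_scale: "pcoeff_into z i (scale a v) = scale a (pcoeff_into z i v)"
  by (cases i)
    (simp_all add: pcoeff_into_def pcoeff_def A_scale scale_right_diff_distrib mult.commute)

lemma pcoeff_into_sum: "pcoeff_into z i (sum f X) = (\<Sum>x\<in>X. pcoeff_into z i (f x))"
proof -
  have "pcoeff_into z i 0 = 0" using pcoeff_into_scale[of z i 0 0] by simp
  then show ?thesis
    by (induction X rule: infinite_finite_induct) (auto simp: pcoeff_into_add)
qed

lemma coeff_eq_sum_powers:
  "coeff m n v = (\<Sum>i\<le>Suc r. scale (of_int m ^ i) (pcoeff (\<alpha> + of_int n) i v))"
  unfolding coeff_eq S_def sum.atMost_Suc_shift by (simp add: pcoeff_def)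

lemma coeff_into_eq_sum_powers:
  "coeff m (l - m) v = (\<Sum>i\<le>Suc r. scale (of_int m ^ i) (pcoeff_into (\<alpha> + of_int l) i v))"
proof -
  have "(\<Sum>i\<le>Suc r. scale (of_int m ^ i) (if i = 1 then v else 0)) =
      (\<Sum>i\<le>Suc r. if i = 1 then scale (of_int m) v else 0)"
    by (intro sum.cong) auto
  also have "\<dots> = scale (of_int m) v" by simp
  finally have "(\<Sum>i\<le>Suc r. scale (of_int m ^ i) (pcoeff_into (\<alpha> + of_int l) i v)) =
      coeff m l v - scale (of_int m) v"
    unfolding pcoeff_into_def coeff_eq_sum_powers scale_right_diff_distrib sum_subtractf by simp
  then show ?thesis
    by (simp add: coeff_eq scale_left_distrib scale_left_diff_distrib algebra_simps)
qed


section \<open>Relations between the slices\<close>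

text \<open>The two-step action \<open>d\<^sub>m d\<^bsub>k-m\<^esub>\<close> from degree \<open>n\<close> to degree \<open>n + k\<close> is polynomial in \<open>m\<close>, and its
  coefficient at \<open>m\<^bsup>2r+2\<^esup>\<close> is a nonzero multiple of the square of \<open>A r\<close>.\<close>

lemma top_square_mem_slice:
  assumes "r \<ge> 1" and W: "lie_submodule virasoro (N_scale scale) Na W" and v: "v \<in> slice W n"
  shows "A r (A r v) \<in> slice W l"
proof -
  have sub: "subspace (slice W l)"
    using W by (intro subspace_slice) (simp add: lie_submodule_def)
  define k where "k = l - n"
  define J where "J = {..Suc r} \<times> {..Suc r}"
  define p :: "nat \<times> nat \<Rightarrow> complex poly" where
    "p = (\<lambda>(i, j). monom 1 i * [:of_int k, -1:] ^ j)"
  define u where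
    "u = (\<lambda>(i, j). pcoeff_into (\<alpha> + of_int l) i (pcoeff (\<alpha> + of_int n) j v))"
  have mem: "(\<Sum>x\<in>J. scale (poly (p x) (of_int m)) (u x)) \<in> slice W l" for m
  proof -
    have "coeff m (l - m) (coeff (k - m) n v) \<in> slice W l"
      using coeff_mem_slice[OF W coeff_mem_slice[OF W v, of "k - m"], of m] by (simp add: k_def)
    also have "coeff m (l - m) (coeff (k - m) n v) =
        (\<Sum>i\<le>Suc r. \<Sum>j\<le>Suc r. scale (of_int m ^ i * of_int (k - m) ^ j) (u (i, j)))"
      unfolding coeff_into_eq_sum_powers unfolding coeff_eq_sum_powers
      by (simp only: pcoeff_into_sum pcoeff_into_scale scale_sum_right scale_scale u_def prod.case)
    also have "\<dots> = (\<Sum>x\<in>J. scale (poly (p x) (of_int m)) (u x))"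
      unfolding J_def sum.cartesian_product
      by (intro sum.cong) (auto simp: p_def poly_monom poly_power)
    finally show ?thesis .
  qed
  have "(\<Sum>x\<in>J. scale (Polynomial.coeff (p x) (Suc r + Suc r)) (u x)) \<in> slice W l"
  proof (rule poly_coefficients_mem[OF vs sub _ mem order_refl])
    fix x assume "x \<in> J"
    then show "degree (p x) \<le> Suc r + Suc r"
      using monom_linear_power_coeff(1)[of "fst x" "of_int k" "snd x"]
      by (auto simp: J_def p_def intro: order_trans)
  qed
  also have "(\<Sum>x\<in>J. scale (Polynomial.coeff (p x) (Suc r + Suc r)) (u x)) =
      (\<Sum>x\<in>{(Suc r, Suc r)}. scale (Polynomial.coeff (p x) (Suc r + Suc r)) (u x))"
  proof (rule sum.mono_neutral_right)
    show "\<forall>x\<in>J - {(Suc r, Suc r)}. scale (Polynomial.coeff (p x) (Suc r + Suc r)) (u x) = 0"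
    proof
      fix x assume "x \<in> J - {(Suc r, Suc r)}"
      then have "fst x + snd x < Suc r + Suc r" by (cases x) (auto simp: J_def)
      then have "Polynomial.coeff (p x) (Suc r + Suc r) = 0"
        unfolding p_def case_prod_beta by (rule monom_linear_power_coeff(2))
      then show "scale (Polynomial.coeff (p x) (Suc r + Suc r)) (u x) = 0" by simp
    qed
  qed (auto simp: J_def)
  also have "\<dots> = scale ((-1) ^ Suc r) (u (Suc r, Suc r))"
    using monom_linear_power_coeff(3)[of "Suc r" "of_int k :: complex" "Suc r"]
    by (simp only: p_def prod.case sum.insert finite.emptyI empty_iff not_False_eq_True
        sum.empty add_0_right)
  \<comment> \<open>Here \<open>Suc r \<noteq> 1\<close>, so the shift by \<open>-v\<close> in \<open>pcoeff_into\<close> is absent.\<close>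
  also have "u (Suc r, Suc r) = scale (1 / fact (Suc r)) (scale (1 / fact (Suc r)) (A r (A r v)))"
    using \<open>r \<ge> 1\<close> by (simp add: u_def pcoeff_into_def pcoeff_def A_scale)
  finally have "scale ((-1) ^ Suc r / (fact (Suc r) * fact (Suc r))) (A r (A r v)) \<in> slice W l"
    by simp
  moreover define c :: complex where "c = (-1) ^ Suc r / (fact (Suc r) * fact (Suc r))"
  ultimately have "scale (inverse c) (scale c (A r (A r v))) \<in> slice W l"
    using subspace_scale[OF sub] by blast
  moreover have "c \<noteq> 0" by (simp add: c_def del: fact_Suc)
  ultimately show ?thesis by simp
qed

text \<open>For \<open>v\<close> in every slice, all the vectors \<open>d\<^sub>m (v \<otimes> t\<^bsup>l-m\<^esup>)\<close> lie in the single slice of degree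
  \<open>l\<close>, which therefore contains their coefficients in \<open>m\<close>: nonzero multiples of \<open>A i v\<close>, shifted by
  \<open>-v\<close> for \<open>i = 0\<close>.\<close>

lemma A_mem_Inter_slices:
  assumes W: "lie_submodule virasoro (N_scale scale) Na W" and v: "v \<in> (\<Inter>n. slice W n)"
  shows "A i v \<in> (\<Inter>n. slice W n)"
proof
  fix l
  have sub: "subspace (slice W l)"
    using W by (intro subspace_slice) (simp add: lie_submodule_def)
  show "A i v \<in> slice W l"
  proof (cases "i \<le> r")
    case True
    have "pcoeff_into (\<alpha> + of_int l) (Suc i) v \<in> slice W l"
    proof (rule power_coefficients_mem[OF vs sub])
      fix m :: int
      have "coeff m (l - m) v \<in> slice W (l - m + m)"
        using v by (intro coeff_mem_slice[OF W]) auto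
      then show "(\<Sum>i\<le>Suc r. scale (of_int m ^ i) (pcoeff_into (\<alpha> + of_int l) i v)) \<in> slice W l"
        by (simp only: coeff_into_eq_sum_powers diff_add_cancel)
    qed (use True in simp)
    then have "pcoeff_into (\<alpha> + of_int l) (Suc i) v + (if i = 0 then v else 0) \<in> slice W l"
      using v by (intro subspace_add[OF sub]) (auto simp: subspace_0[OF sub])
    then have "scale (1 / fact (Suc i)) (A i v) \<in> slice W l"
      by (simp add: pcoeff_into_def pcoeff_def split: if_splits)
    from subspace_scale[OF sub this, of "fact (Suc i)"] show ?thesis
      by (simp del: fact_Suc)
  next
    case False
    then show ?thesis by (simp add: A_high subspace_0[OF sub])
  qed
qed

text \<open>The operators \<open>A i\<close> suffice to test submodules, because the \<open>dbar r i\<close> span \<open>a_alg r\<close>.\<close>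

lemma submoduleI:
  assumes U: "subspace U" and A: "\<And>i v. v \<in> U \<Longrightarrow> A i v \<in> U"
  shows "lie_submodule (a_alg r) scale act U"
proof -
  interpret Q: lie_algebra_ideal vir_plus "vir_plus_ideal r" by (rule lie_algebra_ideal_vir_plus)
  let ?q = "lie_coset vir_plus (vir_plus_ideal r)"
  define P where "P = vir.span {vir_d i |i. 0 \<le> i}"
  have vir_plus: "lcarrier vir_plus = P" "ladd vir_plus = (+)" "lsmult vir_plus = pm_scale (*)"
    "lzero vir_plus = 0"
    by (simp_all add: vir_plus_def P_def)
  have P: "vir.subspace P" by (simp add: P_def)
  have q_closed: "?q x \<in> lcarrier (a_alg r)" if "x \<in> P" for x
    using that by (auto simp: a_alg_def Q.quot_sel vir_plus)
  have q_add: "?q (x + y) = ladd (a_alg r) (?q x) (?q y)" if "x \<in> P" "y \<in> P" for x y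
    using Q.quot_add[of x y] that by (simp add: a_alg_def vir_plus)
  have q_scale: "?q (pm_scale (*) a x) = lsmult (a_alg r) a (?q x)" if "x \<in> P" for a x
    using Q.quot_smult[of x a] that by (simp add: a_alg_def vir_plus)
  have "act (?q x) v \<in> U" if v: "v \<in> U" and x: "x \<in> P" for x v
  proof -
    have "P \<subseteq> {x \<in> P. act (?q x) v \<in> U}"
      unfolding P_def
    proof (rule vir.span_minimal, unfold P_def[symmetric])
      show "{vir_d i |i. 0 \<le> i} \<subseteq> {x \<in> P. act (?q x) v \<in> U}"
      proof safe
        fix i :: int assume "0 \<le> i"
        then show "vir_d i \<in> P" unfolding P_def by (intro vir.span_base) auto
        from \<open>0 \<le> i\<close> have "?q (vir_d i) = dbar r (nat i)" by (simp add: dbar_def)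
        then show "act (?q (vir_d i)) v \<in> U" using A[OF v] by simp
      qed
      have "?q 0 = dbar r (Suc r)"
        using dbar_eq_zero[of r "Suc r"] by (simp add: a_alg_def Q.quot_sel vir_plus)
      then have "act (?q 0) v \<in> U" using A[OF v] by simp
      then show "vir.subspace {x \<in> P. act (?q x) v \<in> U}"
        using P U unfolding vir.subspace_def subspace_def
        by (simp add: q_add q_scale act_add_left act_smult_left q_closed)
    qed
    then show ?thesis using x by blast
  qed
  then show ?thesis
    using U by (auto simp: lie_submodule_def a_alg_def Q.quot_sel vir_plus)
qed

lemma submodule_Inter_slices:
  assumes W: "lie_submodule virasoro (N_scale scale) Na W"
  shows "lie_submodule (a_alg r) scale act (\<Inter>n. slice W n)"
proof (rule submoduleI)
  show "subspace (\<Inter>n. slice W n)"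
    using W by (intro subspace_Inter) (auto simp: lie_submodule_def intro: subspace_slice)
qed (use A_mem_Inter_slices[OF W] in blast)

end


section \<open>Simplicity\<close>

theorem theorem4:
  fixes r :: nat
    and scale :: "complex \<Rightarrow> 'm::ab_group_add \<Rightarrow> 'm"
    and act :: "vir set \<Rightarrow> 'm \<Rightarrow> 'm"
    and \<alpha> :: complex
  assumes "r \<ge> 1"
    and "simple_lie_module (a_alg r) scale act"
    and "inj (act (dbar r r))"
  shows "simple_lie_module virasoro (N_scale scale) (N_act r scale act \<alpha>)"
proof -
  interpret a_module r scale act \<alpha>
    using assms(2) by (simp add: a_module_def simple_lie_module_def)
  obtain v0 :: 'm where v0: "v0 \<noteq> 0"
    using assms(2) by (auto simp: simple_lie_module_def)
  have "W = {0} \<or> W = UNIV" if W: "lie_submodule virasoro (N_scale scale) Na W" for W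
  proof (cases "W = {0}")
    case False
    have sub: "N.subspace W" using W by (simp add: lie_submodule_def)
    obtain f where f: "f \<in> W" "f \<noteq> 0"
      using False N.subspace_0[OF sub] by blast
    then obtain n where n: "Poly_Mapping.lookup f n \<noteq> 0"
      by (metis lookup_zero poly_mapping_eqI)
    define v where "v = Poly_Mapping.lookup f n"
    have "v \<in> slice W n" unfolding slice_def v_def using single_lookup_mem[OF W f(1)] by simp
    then have "A r (A r v) \<in> (\<Inter>l. slice W l)"
      using top_square_mem_slice[OF \<open>r \<ge> 1\<close> W] by blast
    moreover have "A r (A r v) \<noteq> 0"
      using injD[OF assms(3), of _ 0] n by (auto simp: v_def)
    ultimately have "(\<Inter>l. slice W l) = UNIV"
      using assms(2) submodule_Inter_slices[OF W] unfolding simple_lie_module_def by blast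
    then have single: "Poly_Mapping.single n w \<in> W" for n w
      by (auto simp: slice_def)
    have "g \<in> W" for g
      by (induction g rule: poly_mapping_add_induct)
        (auto intro: single N.subspace_0[OF sub] N.subspace_add[OF sub])
    then show ?thesis by blast
  qed simp
  moreover have "Poly_Mapping.single (0::int) v0 \<noteq> 0"
    using v0 by (metis lookup_single_eq lookup_zero)
  ultimately show ?thesis
    unfolding simple_lie_module_def using lie_module_N by blast
qed

end
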